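(* Let $M$ be a Riemannian manifold and let $\mu$ be a Borel probability measure on $M$, absolutely continuous with respect to the volume measure. Let $\beta:(0,+\infty)\to\mathbb{R}^+$ be a non-increasing function, and suppose that $\mu$ satisfies a weak spectral gap inequality with function $\beta$: for every locally Lipschitz $f:M\to\mathbb{R}$ and every $s>0$, $$\mathbf{Var}_\mu(f)\le\beta(s)\int|\nabla f|^2\,d\mu+s\,\mathbf{Osc}(f)^2 .$$ Let $F:M\to\mathbb{R}$ be an $L$-Lipschitz function ($L>0$) with median $m$ under $\mu$. Then for every integer $k\ge1$ and every $s\in(0,1/4)$, one has $$\mu(F-m>k)\le\frac{s}{1+L^2\beta(s)}+\mu(F-m>k-1)\left(1-\frac{1}{2(1+L^2\beta(s))}\right).$$ Consequently, for every integer $k\ge1$ and every $s\in(0,1/4)$, $$\mu(F-m>k)\le2s+\frac{\sqrt e}{2}\exp\Big(\frac{-k}{4L\sqrt{\beta(s)}}\Big).$$ Thus $\mu(|F-m|>k)\le6\,\Theta(k/L)$ for every integer $k\ge1$, where $$\Theta(u)=\inf\Big\{s\in(0,1/4]:\ \exp\Big(\frac{-u}{4\sqrt{\beta(s)}}\Big)\le s\Big\}$$ tends to $0$ when $u$ tends to $+\infty$.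
   Context: For locally Lipschitz $f:M\to\mathbb{R}$, $|\nabla f|(x)=\limsup_{y\to x}\frac{|f(x)-f(y)|}{d(x,y)}$, where $d$ is the geodesic distance. $\mathbf{Var}_\mu(f)$ is the variance of $f$ under $\mu$, and $\mathbf{Osc}(f)=\sup f-\inf f$. Lipschitz is with respect to $d$. Since $\mathbf{Var}_\mu(f)\le\mathbf{Osc}(f)^2/4$, the weak spectral gap inequality is trivial for $s\ge1/4$ and one may set $\beta(s)=0$ for $s\ge1/4$; in the definition of $\Theta$, the exponential is read as $0$ when $\beta(s)=0$. *)

theory Defs
  imports "HOL-Probability.Probability"
begin

section \<open>Smooth maps between open subsets of normed spaces\<close>

text \<open>Only meaningful for open \<open>S\<close>, where the Frechet derivative is unique.\<close>

primrec Ck_on :: "nat \<Rightarrow> 'a::real_normed_vector set \<Rightarrow> ('a \<Rightarrow> 'b::real_normed_vector) \<Rightarrow> bool" where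
  "Ck_on 0 S f \<longleftrightarrow> continuous_on S f"
| "Ck_on (Suc k) S f \<longleftrightarrow>
     (\<forall>x\<in>S. f differentiable (at x)) \<and> (\<forall>v. Ck_on k S (\<lambda>x. frechet_derivative f (at x) v))"

definition smooth_on :: "'a::real_normed_vector set \<Rightarrow> ('a \<Rightarrow> 'b::real_normed_vector) \<Rightarrow> bool" where
  "smooth_on S f \<longleftrightarrow> (\<forall>k. Ck_on k S f)"

section \<open>Riemannian manifolds\<close>

text \<open>
  The manifold is the whole type \<open>'a\<close>, of dimension \<open>CARD('n)\<close>. A chart is a pair of an open domain
  and a coordinate map (irrelevant outside the domain). A Riemannian metric is given by its local
  representations: \<open>g c p v w\<close> is the inner product at \<open>p\<close> of the two tangent vectors whose
  coordinates in the chart \<open>c\<close> are \<open>v\<close> and \<open>w\<close>. Connectedness is not required; the geodesic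
  distance below is \<open>\<infinity>\<close> between distinct components.
\<close>

type_synonym ('a, 'n) chart = "'a set \<times> ('a \<Rightarrow> real ^ 'n)"

type_synonym ('a, 'n) metric_tensor =
  "('a, 'n) chart \<Rightarrow> 'a \<Rightarrow> real ^ 'n \<Rightarrow> real ^ 'n \<Rightarrow> real"

definition chart_inv :: "('a, 'n) chart \<Rightarrow> real ^ 'n \<Rightarrow> 'a" where
  "chart_inv c = inv_into (fst c) (snd c)"

locale riemannian_manifold =
  fixes A :: "('a::{second_countable_topology, t2_space}, 'n::finite) chart set"
    and g :: "('a, 'n) metric_tensor"
  assumes open_domain: "c \<in> A \<Longrightarrow> open (fst c)"
    and open_range: "c \<in> A \<Longrightarrow> open (snd c ` fst c)"
    and chart_homeomorphism:
      "c \<in> A \<Longrightarrow> homeomorphism (fst c) (snd c ` fst c) (snd c) (chart_inv c)"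
    and charts_cover: "(\<Union>c\<in>A. fst c) = UNIV"
    and smooth_transition:
      "c \<in> A \<Longrightarrow> c' \<in> A \<Longrightarrow> smooth_on (snd c ` (fst c \<inter> fst c')) (snd c' \<circ> chart_inv c)"
    and metric_bilinear: "c \<in> A \<Longrightarrow> p \<in> fst c \<Longrightarrow> bilinear (g c p)"
    and metric_sym: "c \<in> A \<Longrightarrow> p \<in> fst c \<Longrightarrow> g c p v w = g c p w v"
    and metric_pos: "c \<in> A \<Longrightarrow> p \<in> fst c \<Longrightarrow> v \<noteq> 0 \<Longrightarrow> g c p v v > 0"
    and metric_smooth: "c \<in> A \<Longrightarrow> smooth_on (snd c ` fst c) (\<lambda>y. g c (chart_inv c y) v w)"
    and metric_transition:
      "c \<in> A \<Longrightarrow> c' \<in> A \<Longrightarrow> p \<in> fst c \<inter> fst c' \<Longrightarrow>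
        g c p v w =
          g c' p (frechet_derivative (snd c' \<circ> chart_inv c) (at (snd c p)) v)
                 (frechet_derivative (snd c' \<circ> chart_inv c) (at (snd c p)) w)"

subsection \<open>Geodesic distance\<close>

definition piecewise_C1_curve ::
    "('a::topological_space, 'n::finite) chart set \<Rightarrow> (real \<Rightarrow> 'a) \<Rightarrow> bool" where
  "piecewise_C1_curve A \<gamma> \<longleftrightarrow>
     continuous_on {0..1} \<gamma> \<and>
     (\<forall>c\<in>A. \<forall>a b. 0 \<le> a \<longrightarrow> a \<le> b \<longrightarrow> b \<le> 1 \<longrightarrow> \<gamma> ` {a..b} \<subseteq> fst c \<longrightarrow>
        (snd c \<circ> \<gamma>) piecewise_C1_differentiable_on {a..b})"

text \<open>
  By the transformation law of the metric, the speed does not depend on the chart chosen around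
  \<open>\<gamma> t\<close>, at every \<open>t\<close> where the curve is differentiable.
\<close>

definition speed ::
    "('a, 'n::finite) chart set \<Rightarrow> ('a, 'n) metric_tensor \<Rightarrow> (real \<Rightarrow> 'a) \<Rightarrow> real \<Rightarrow> real" where
  "speed A g \<gamma> t =
     (let c = (SOME c. c \<in> A \<and> \<gamma> t \<in> fst c);
          v = vector_derivative (snd c \<circ> \<gamma>) (at t)
      in sqrt (g c (\<gamma> t) v v))"

definition curve_length ::
    "('a, 'n::finite) chart set \<Rightarrow> ('a, 'n) metric_tensor \<Rightarrow> (real \<Rightarrow> 'a) \<Rightarrow> ennreal" where
  "curve_length A g \<gamma> = (\<integral>\<^sup>+ t \<in> {0..1}. ennreal (speed A g \<gamma> t) \<partial>lborel)"

definition geodesic_dist ::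
    "('a::topological_space, 'n::finite) chart set \<Rightarrow> ('a, 'n) metric_tensor \<Rightarrow> 'a \<Rightarrow> 'a \<Rightarrow> ennreal"
  where
  "geodesic_dist A g x y =
     (INF \<gamma> \<in> {\<gamma>. piecewise_C1_curve A \<gamma> \<and> \<gamma> 0 = x \<and> \<gamma> 1 = y}. curve_length A g \<gamma>)"

subsection \<open>Volume measure\<close>

definition volume_density ::
    "('a, 'n::finite) metric_tensor \<Rightarrow> ('a, 'n) chart \<Rightarrow> 'a \<Rightarrow> real" where
  "volume_density g c p = sqrt (det (\<chi> i j. g c p (axis i 1) (axis j 1)))"

definition is_riemannian_volume ::
    "('a::topological_space, 'n::finite) chart set \<Rightarrow> ('a, 'n) metric_tensor \<Rightarrow> 'a measure \<Rightarrow> bool"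
  where
  "is_riemannian_volume A g V \<longleftrightarrow>
     sets V = sets borel \<and>
     (\<forall>c\<in>A. \<forall>B\<in>sets borel. B \<subseteq> fst c \<longrightarrow>
        emeasure V B =
          (\<integral>\<^sup>+ y \<in> snd c ` B. ennreal (volume_density g c (chart_inv c y)) \<partial>lborel))"

text \<open>
  Existence follows from the change of variables formula and the transformation law of the metric,
  uniqueness from the existence of a countable cover by chart domains.
\<close>

definition riemannian_volume ::
    "('a::topological_space, 'n::finite) chart set \<Rightarrow> ('a, 'n) metric_tensor \<Rightarrow> 'a measure" where
  "riemannian_volume A g = (THE V. is_riemannian_volume A g V)"

section \<open>Lipschitz functions and the length of the gradient\<close>

text \<open>In this section \<open>d\<close> stands for an extended distance; it will be the geodesic distance.\<close>

definition lipschitz_wrt :: "('a \<Rightarrow> 'a \<Rightarrow> ennreal) \<Rightarrow> real \<Rightarrow> 'a set \<Rightarrow> ('a \<Rightarrow> real) \<Rightarrow> bool" where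
  "lipschitz_wrt d L U f \<longleftrightarrow> (\<forall>x\<in>U. \<forall>y\<in>U. ennreal \<bar>f x - f y\<bar> \<le> ennreal L * d x y)"

definition locally_lipschitz_wrt ::
    "('a::topological_space \<Rightarrow> 'a \<Rightarrow> ennreal) \<Rightarrow> ('a \<Rightarrow> real) \<Rightarrow> bool" where
  "locally_lipschitz_wrt d f \<longleftrightarrow> (\<forall>x. \<exists>U C. open U \<and> x \<in> U \<and> C \<ge> 0 \<and> lipschitz_wrt d C U f)"

definition slope ::
    "('a::topological_space \<Rightarrow> 'a \<Rightarrow> ennreal) \<Rightarrow> ('a \<Rightarrow> real) \<Rightarrow> 'a \<Rightarrow> ennreal" where
  "slope d f x = Limsup (at x) (\<lambda>y. ennreal \<bar>f x - f y\<bar> / d x y)"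

section \<open>Weak spectral gap inequalities\<close>

definition Osc :: "('a \<Rightarrow> real) \<Rightarrow> ennreal" where
  "Osc f = e2ennreal ((SUP x. ereal (f x)) - (INF x. ereal (f x)))"

text \<open>
  Both sides are compared in \<open>[0, \<infinity>]\<close>, with \<open>0 * \<infinity> = 0\<close>. For unbounded \<open>f\<close> the right-hand side
  is \<open>\<infinity>\<close>, so the value of the Bochner variance of a non-integrable function is irrelevant.
\<close>

definition weak_spectral_gap ::
    "('a::topological_space \<Rightarrow> 'a \<Rightarrow> ennreal) \<Rightarrow> 'a measure \<Rightarrow> (real \<Rightarrow> real) \<Rightarrow> bool" where
  "weak_spectral_gap d \<mu> \<beta> \<longleftrightarrow>
     (\<forall>f s. locally_lipschitz_wrt d f \<longrightarrow> s > 0 \<longrightarrow>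
        ennreal (prob_space.variance \<mu> f)
          \<le> ennreal (\<beta> s) * (\<integral>\<^sup>+ x. (slope d f x)\<^sup>2 \<partial>\<mu>) + ennreal s * (Osc f)\<^sup>2)"

definition is_median :: "'a measure \<Rightarrow> ('a \<Rightarrow> real) \<Rightarrow> real \<Rightarrow> bool" where
  "is_median \<mu> F m \<longleftrightarrow>
     measure \<mu> {x \<in> space \<mu>. F x \<ge> m} \<ge> 1/2 \<and> measure \<mu> {x \<in> space \<mu>. F x \<le> m} \<ge> 1/2"

text \<open>The value of \<open>exp (- a / b)\<close>, read as \<open>0\<close> for \<open>b = 0\<close>.\<close>

definition exp_quot :: "real \<Rightarrow> real \<Rightarrow> real" where
  "exp_quot a b = (if b = 0 then 0 else exp (- a / b))"

text \<open>
  Here \<open>\<beta> s\<close> is read as \<open>0\<close> for \<open>s \<ge> 1/4\<close>, where the weak spectral gap inequality is trivial. Hence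
  \<open>1/4\<close> always belongs to the set, and the infimum is not affected if the set was nonempty without
  this convention.
\<close>

definition Theta :: "(real \<Rightarrow> real) \<Rightarrow> real \<Rightarrow> real" where
  "Theta \<beta> u = Inf {s \<in> {0<..1/4}. exp_quot u (4 * sqrt (if s < 1/4 then \<beta> s else 0)) \<le> s}"

end

theory Submission
  imports Defs
begin

text \<open>
  Testing the weak spectral gap inequality on the truncation of \<open>F\<close> between two consecutive levels
  bounds the tail at level \<open>k\<close> by the tail at level \<open>k - 1\<close>: the truncation vanishes on
  \<open>{F \<le> m}\<close>, of measure at least \<open>1/2\<close>, so its variance is at least half its second moment.
  Iterating for a rescaled \<open>F\<close> gives exponential decay. The geometry of the manifold enters only
  through the continuity of Lipschitz functions: segments in a chart show that the geodesic distance
  is locally bounded by the Euclidean distance of the coordinates.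
\<close>

section \<open>Continuity of Lipschitz functions on a Riemannian manifold\<close>

text \<open>Expand \<open>w\<close> in the orthonormal basis and bound every coordinate by
  \<open>norm w\<close>. The constant is a finite sum of absolute matrix entries, so it varies
  continuously when the entries of \<open>h\<close> do.\<close>

lemma bilinear_diagonal_le:
  fixes h :: "'a::euclidean_space \<Rightarrow> 'a \<Rightarrow> real"
  assumes "bilinear h"
  shows "h w w \<le> (\<Sum>(i, j)\<in>Basis \<times> Basis. \<bar>h i j\<bar>) * (norm w)\<^sup>2"
proof -
  have "h w w = h (\<Sum>i\<in>Basis. (w \<bullet> i) *\<^sub>R i) (\<Sum>j\<in>Basis. (w \<bullet> j) *\<^sub>R j)"
    by (simp only: euclidean_representation)
  also have "\<dots> = (\<Sum>(i, j)\<in>Basis \<times> Basis. (w \<bullet> i) * ((w \<bullet> j) * h i j))"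
    by (simp add: bilinear_sum[OF assms] bilinear_lmul[OF assms] bilinear_rmul[OF assms]
        mult.left_commute)
  also have "\<dots> \<le> (\<Sum>(i, j)\<in>Basis \<times> Basis. \<bar>h i j\<bar> * (norm w)\<^sup>2)"
  proof (rule sum_mono, clarify)
    fix i j :: 'a assume ij: "i \<in> Basis" "j \<in> Basis"
    have "(w \<bullet> i) * ((w \<bullet> j) * h i j) \<le> \<bar>w \<bullet> i\<bar> * (\<bar>w \<bullet> j\<bar> * \<bar>h i j\<bar>)"
      by (metis abs_ge_self abs_mult)
    also have "\<dots> \<le> norm w * (norm w * \<bar>h i j\<bar>)"
      using ij by (intro mult_mono Basis_le_norm) auto
    finally show "(w \<bullet> i) * ((w \<bullet> j) * h i j) \<le> \<bar>h i j\<bar> * (norm w)\<^sup>2"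
      by (simp add: power2_eq_square ac_simps)
  qed
  also have "\<dots> = (\<Sum>(i, j)\<in>Basis \<times> Basis. \<bar>h i j\<bar>) * (norm w)\<^sup>2"
    by (simp add: sum_distrib_right case_prod_beta)
  finally show ?thesis .
qed

text \<open>The curve that is straight in the coordinates of \<open>c\<close>, starting at
  coordinates \<open>y\<close> with constant velocity \<open>w\<close>. It is meaningful only while
  \<open>y + t *\<^sub>R w\<close> stays in the range of the chart.\<close>

definition chart_segment :: "('a, 'n) chart \<Rightarrow> real ^ 'n \<Rightarrow> real ^ 'n \<Rightarrow> real \<Rightarrow> 'a" where
  "chart_segment c y w t = chart_inv c (y + t *\<^sub>R w)"

section \<open>Charts, coordinate segments and local bounds on the geodesic distance\<close>

context riemannian_manifold
begin

lemma chart_inv_in: "c \<in> A \<Longrightarrow> y \<in> snd c ` fst c \<Longrightarrow> chart_inv c y \<in> fst c"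
  by (simp add: chart_inv_def inv_into_into)

lemma chart_chart_inv: "c \<in> A \<Longrightarrow> y \<in> snd c ` fst c \<Longrightarrow> snd c (chart_inv c y) = y"
  by (simp add: chart_inv_def f_inv_into_f)

lemma chart_inv_chart: "c \<in> A \<Longrightarrow> p \<in> fst c \<Longrightarrow> chart_inv c (snd c p) = p"
  using chart_homeomorphism by (auto simp: homeomorphism_def)

lemma transition_C1:
  assumes "c \<in> A" "c' \<in> A"
  shows "Ck_on 1 (snd c ` (fst c \<inter> fst c')) (snd c' \<circ> chart_inv c)"
  using smooth_transition[OF assms] by (simp add: smooth_on_def)

lemma transition_domain:
  assumes "c \<in> A" "y \<in> snd c ` fst c" "chart_inv c y \<in> U"
  shows "y \<in> snd c ` (fst c \<inter> U)"
  using assms by (metis IntI chart_chart_inv chart_inv_in imageI)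

text \<open>Chain rule for an affine path followed by a transition map. A second chart
  \<open>c'\<close> is allowed because both \<open>piecewise_C1_curve\<close> and
  \<open>speed\<close> look at the curve in charts other than \<open>c\<close>.\<close>

lemma segment_has_vector_derivative:
  assumes c: "c \<in> A" "c' \<in> A" and y: "y + t *\<^sub>R w \<in> snd c ` fst c"
    and c': "chart_segment c y w t \<in> fst c'"
  shows "((snd c' \<circ> chart_segment c y w) has_vector_derivative
      frechet_derivative (snd c' \<circ> chart_inv c) (at (y + t *\<^sub>R w)) w) (at t)"
proof -
  let ?\<phi> = "snd c' \<circ> chart_inv c" and ?l = "\<lambda>t. y + t *\<^sub>R w"
  have "?\<phi> differentiable (at (?l t))"
    using transition_C1[OF c] transition_domain[OF c(1) y, of "fst c'"] c'
    by (auto simp: chart_segment_def simp del: o_apply)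
  then have D: "(?\<phi> has_derivative frechet_derivative ?\<phi> (at (?l t))) (at (?l t))"
    by (simp add: frechet_derivative_works)
  have "(?l has_derivative (\<lambda>h. h *\<^sub>R w)) (at t)"
    by (auto intro!: derivative_eq_intros)
  from diff_chain_at[OF this D]
  have "(?\<phi> \<circ> ?l has_derivative (\<lambda>h. h *\<^sub>R frechet_derivative ?\<phi> (at (?l t)) w)) (at t)"
    using linear_scale[OF has_derivative_linear[OF D]] by (simp add: o_def)
  moreover have "?\<phi> \<circ> ?l = snd c' \<circ> chart_segment c y w"
    by (auto simp: chart_segment_def)
  ultimately show ?thesis
    by (simp add: has_vector_derivative_def)
qed

text \<open>\<open>speed\<close> measures the velocity in some chosen chart \<open>c'\<close>, where
  it is the image of \<open>w\<close> under the derivative of the transition map. The transformation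
  law \<open>metric_transition\<close> carries the inner product back to \<open>c\<close>.\<close>

lemma speed_segment:
  assumes c: "c \<in> A" and y: "y + t *\<^sub>R w \<in> snd c ` fst c"
  shows "speed A g (chart_segment c y w) t = sqrt (g c (chart_segment c y w t) w w)"
proof -
  let ?p = "chart_segment c y w t"
  define c' where "c' = (SOME c. c \<in> A \<and> ?p \<in> fst c)"
  have p: "?p \<in> fst c" using chart_inv_in[OF c y] by (simp add: chart_segment_def)
  have c': "c' \<in> A \<and> ?p \<in> fst c'"
    unfolding c'_def by (rule someI[of _ c]) (use c p in auto)
  have "snd c ?p = y + t *\<^sub>R w"
    using chart_chart_inv[OF c y] by (simp add: chart_segment_def)
  then have "g c ?p w w = g c' ?p (vector_derivative (snd c' \<circ> chart_segment c y w) (at t))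
      (vector_derivative (snd c' \<circ> chart_segment c y w) (at t))"
    using metric_transition[OF c, of c' ?p w w] c' p
      vector_derivative_at[OF segment_has_vector_derivative[OF c _ y, of c']] by simp
  then show ?thesis
    by (simp add: speed_def c'_def[symmetric] Let_def)
qed

lemma piecewise_C1_segment:
  assumes c: "c \<in> A" and y: "\<And>t. t \<in> {0..1} \<Longrightarrow> y + t *\<^sub>R w \<in> snd c ` fst c"
  shows "piecewise_C1_curve A (chart_segment c y w)"
  unfolding piecewise_C1_curve_def
proof (intro conjI ballI allI impI)
  have "continuous_on (snd c ` fst c) (chart_inv c)"
    using chart_homeomorphism[OF c] by (simp add: homeomorphism_def)
  then have "continuous_on {0..1} (\<lambda>t. chart_inv c (y + t *\<^sub>R w))"
    by (rule continuous_on_compose2) (use y in \<open>auto intro!: continuous_intros\<close>)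
  then show "continuous_on {0..1} (chart_segment c y w)"
    by (simp add: chart_segment_def[abs_def])
next
  fix c' a b
  assume c': "c' \<in> A" and ab: "0 \<le> a" "a \<le> b" "b \<le> 1"
    and sub: "chart_segment c y w ` {a..b} \<subseteq> fst c'"
  let ?\<phi> = "snd c' \<circ> chart_inv c"
  have yt: "y + t *\<^sub>R w \<in> snd c ` fst c" if "t \<in> {a..b}" for t
    using y that ab by auto
  have dom: "y + t *\<^sub>R w \<in> snd c ` (fst c \<inter> fst c')" if "t \<in> {a..b}" for t
    by (rule transition_domain[OF c yt[OF that]]) (use sub that in \<open>auto simp: chart_segment_def\<close>)
  let ?D = "\<lambda>t. frechet_derivative ?\<phi> (at (y + t *\<^sub>R w)) w"
  have "continuous_on (snd c ` (fst c \<inter> fst c')) (\<lambda>z. frechet_derivative ?\<phi> (at z) w)"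
    using transition_C1[OF c c'] by simp
  then have "continuous_on {a..b} ?D"
    by (rule continuous_on_compose2) (use dom in \<open>auto intro!: continuous_intros\<close>)
  moreover have "((snd c' \<circ> chart_segment c y w) has_vector_derivative ?D t) (at t)"
    if "t \<in> {a..b}" for t
    by (rule segment_has_vector_derivative[OF c c' yt[OF that]]) (use sub that in auto)
  ultimately have "(snd c' \<circ> chart_segment c y w) C1_differentiable_on {a..b}"
    unfolding C1_differentiable_on_def
    by (intro exI[where x="?D"] conjI ballI)
  then show "(snd c' \<circ> chart_segment c y w) piecewise_C1_differentiable_on {a..b}"
    by (rule C1_differentiable_imp_piecewise)
qed

text \<open>The sum \<open>G\<close> of the absolute metric coefficients is continuous in
  coordinates, so near the coordinates of \<open>x\<close> it stays below its value there plus 1. By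
  \<open>bilinear_diagonal_le\<close> it dominates the quadratic form.\<close>

lemma metric_locally_bounded:
  assumes c: "c \<in> A" and x: "x \<in> fst c"
  shows "\<exists>r>0. \<exists>C\<ge>0. ball (snd c x) r \<subseteq> snd c ` fst c \<and>
    (\<forall>y\<in>ball (snd c x) r. \<forall>w. g c (chart_inv c y) w w \<le> C * (norm w)\<^sup>2)"
proof -
  let ?R = "snd c ` fst c"
  define G where "G y = (\<Sum>(i, j)\<in>Basis \<times> Basis. \<bar>g c (chart_inv c y) i j\<bar>)" for y
  have "continuous_on ?R (\<lambda>y. g c (chart_inv c y) i j)" for i j
    using metric_smooth[OF c, of i j] unfolding smooth_on_def by (metis Ck_on.simps(1))
  then have "continuous_on ?R G"
    unfolding G_def case_prod_beta by (intro continuous_intros)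
  then have "isCont G (snd c x)"
    using open_range[OF c] x by (simp add: continuous_on_eq_continuous_at)
  then have "eventually (\<lambda>y. G y < G (snd c x) + 1) (nhds (snd c x))"
    by (intro order_tendstoD(2)[of G "G (snd c x)"]) (auto simp: isCont_def tendsto_at_iff_tendsto_nhds)
  moreover have "eventually (\<lambda>y. y \<in> ?R) (nhds (snd c x))"
    using open_range[OF c] x by (intro eventually_nhds_in_open) auto
  ultimately have "eventually (\<lambda>y. G y < G (snd c x) + 1 \<and> y \<in> ?R) (nhds (snd c x))"
    by (rule eventually_conj)
  then obtain r where r: "r > 0" "\<And>y. dist y (snd c x) < r \<Longrightarrow> G y < G (snd c x) + 1 \<and> y \<in> ?R"
    unfolding eventually_nhds_metric by blast
  have "g c (chart_inv c y) w w \<le> (G (snd c x) + 1) * (norm w)\<^sup>2" if "y \<in> ball (snd c x) r" for y w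
  proof -
    have y: "G y < G (snd c x) + 1" "y \<in> ?R" using r(2)[of y] that by (auto simp: dist_commute)
    have "g c (chart_inv c y) w w \<le> G y * (norm w)\<^sup>2"
      unfolding G_def
      by (rule bilinear_diagonal_le[OF metric_bilinear[OF c chart_inv_in[OF c y(2)]]])
    also have "\<dots> \<le> (G (snd c x) + 1) * (norm w)\<^sup>2"
      using y by (intro mult_right_mono) auto
    finally show ?thesis .
  qed
  moreover have "G (snd c x) + 1 \<ge> 0"
    unfolding G_def by (intro add_nonneg_nonneg sum_nonneg) auto
  moreover have "ball (snd c x) r \<subseteq> ?R" using r(2) by (auto simp: dist_commute)
  ultimately show ?thesis using r(1) by blast
qed

text \<open>The coordinate segment from \<open>x\<close> to \<open>z\<close> competes in the
  infimum. It remains in the ball where the metric is bounded by \<open>C\<close>, so its speed, and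
  hence its length over the unit interval, is at most \<open>sqrt C\<close> times the coordinate
  distance.\<close>

lemma geodesic_dist_locally_le:
  assumes c: "c \<in> A" and x: "x \<in> fst c"
  shows "\<exists>r>0. \<exists>K\<ge>0. \<forall>z\<in>fst c. snd c z \<in> ball (snd c x) r \<longrightarrow>
    geodesic_dist A g x z \<le> ennreal (K * norm (snd c z - snd c x))"
proof -
  obtain r C where r: "r > 0" "C \<ge> 0" "ball (snd c x) r \<subseteq> snd c ` fst c"
    and C: "\<And>y w. y \<in> ball (snd c x) r \<Longrightarrow> g c (chart_inv c y) w w \<le> C * (norm w)\<^sup>2"
    using metric_locally_bounded[OF assms] by blast
  have "geodesic_dist A g x z \<le> ennreal (sqrt C * norm (snd c z - snd c x))"
    if z: "z \<in> fst c" "snd c z \<in> ball (snd c x) r" for z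
  proof -
    define y w where "y = snd c x" and "w = snd c z - snd c x"
    have seg: "y + t *\<^sub>R w \<in> ball y r" if t: "t \<in> {0..1}" for t
    proof -
      have "norm (t *\<^sub>R w) \<le> norm w" using t by (simp add: mult_left_le_one_le)
      also have "\<dots> < r" using z(2) by (simp add: w_def dist_norm norm_minus_commute)
      finally show ?thesis by (simp add: dist_norm)
    qed
    have in_R: "y + t *\<^sub>R w \<in> snd c ` fst c" if "t \<in> {0..1}" for t
      using seg[OF that] r(3) by (auto simp: y_def)
    have "geodesic_dist A g x z \<le> curve_length A g (chart_segment c y w)"
      unfolding geodesic_dist_def
      by (rule INF_lower) (use piecewise_C1_segment[OF c in_R] in
        \<open>auto simp: chart_segment_def y_def w_def chart_inv_chart[OF c] x z\<close>)
    also have "\<dots> \<le> (\<integral>\<^sup>+ t. ennreal (sqrt C * norm w) * indicator {0..1::real} t \<partial>lborel)"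
      unfolding curve_length_def
    proof (rule nn_integral_mono)
      fix t :: real
      have "speed A g (chart_segment c y w) t \<le> sqrt C * norm w" if t: "t \<in> {0..1}"
      proof -
        have "speed A g (chart_segment c y w) t \<le> sqrt (C * (norm w)\<^sup>2)"
          unfolding speed_segment[OF c in_R[OF t]]
          using C[of "y + t *\<^sub>R w" w] seg[OF t] by (simp add: chart_segment_def y_def)
        then show ?thesis by (simp add: real_sqrt_mult)
      qed
      then show "ennreal (speed A g (chart_segment c y w) t) * indicator {0..1} t
          \<le> ennreal (sqrt C * norm w) * indicator {0..1} t"
        by (auto simp: indicator_def intro!: ennreal_leI)
    qed
    also have "\<dots> = ennreal (sqrt C * norm w)"
      by (simp add: nn_integral_cmult_indicator)
    finally show ?thesis by (simp add: w_def)
  qed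
  then show ?thesis using r(1,2) by (metis real_sqrt_ge_zero)
qed

text \<open>The Lipschitz condition concerns \<open>geodesic_dist\<close>, continuity the topology
  of the type. In a chart around \<open>x\<close> the former distance is bounded by the coordinate
  distance, which tends to 0 because the chart is continuous.\<close>

lemma lipschitz_imp_continuous:
  assumes F: "lipschitz_wrt (geodesic_dist A g) L UNIV F"
  shows "continuous_on UNIV F"
proof (rule continuous_at_imp_continuous_on, rule ballI)
  fix x :: 'a
  obtain c where c: "c \<in> A" and x: "x \<in> fst c" using charts_cover by blast
  obtain r K where r: "r > 0" "K \<ge> 0"
    and K: "\<And>z. z \<in> fst c \<Longrightarrow> snd c z \<in> ball (snd c x) r \<Longrightarrow>
      geodesic_dist A g x z \<le> ennreal (K * norm (snd c z - snd c x))"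
    using geodesic_dist_locally_le[OF c x] by blast
  have "continuous_on (fst c) (snd c)"
    using chart_homeomorphism[OF c] by (simp add: homeomorphism_def)
  then have "isCont (snd c) x"
    using open_domain[OF c] x by (simp add: continuous_on_eq_continuous_at)
  then have lim: "(snd c \<longlongrightarrow> snd c x) (at x)" by (simp add: isCont_def)
  have "((\<lambda>z. F z - F x) \<longlongrightarrow> 0) (at x)"
  proof (rule Lim_null_comparison)
    \<comment> \<open>The maximum covers negative \<open>L\<close>, for which
      \<open>ennreal L\<close> is 0.\<close>
    show "((\<lambda>z. max 0 L * (K * norm (snd c z - snd c x))) \<longlongrightarrow> 0) (at x)"
      by (auto intro!: tendsto_eq_intros lim)
    have "eventually (\<lambda>z. z \<in> fst c) (at x)"
      using open_domain[OF c] x by (rule eventually_at_in_open')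
    moreover have "eventually (\<lambda>z. snd c z \<in> ball (snd c x) r) (at x)"
      using lim by (rule topological_tendstoD) (use r in auto)
    ultimately show "eventually (\<lambda>z. norm (F z - F x) \<le> max 0 L * (K * norm (snd c z - snd c x))) (at x)"
    proof eventually_elim
      case (elim z)
      have "ennreal \<bar>F x - F z\<bar> \<le> ennreal L * geodesic_dist A g x z"
        using F by (simp add: lipschitz_wrt_def)
      also have "\<dots> \<le> ennreal (max 0 L) * ennreal (K * norm (snd c z - snd c x))"
        using elim by (intro mult_mono ennreal_leI K) auto
      also have "\<dots> = ennreal (max 0 L * (K * norm (snd c z - snd c x)))"
        using r by (simp add: ennreal_mult)
      finally show ?case
        using r by (subst (asm) ennreal_le_iff) (auto simp: abs_minus_commute)
    qed
  qed
  then show "isCont F x" by (simp add: isCont_def LIM_zero_iff)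
qed

end

section \<open>Slopes, variances and oscillations\<close>

lemma slope_le:
  assumes "lipschitz_wrt d L UNIV f"
  shows "slope d f x \<le> ennreal L"
  unfolding slope_def
proof (rule Limsup_bounded, rule always_eventually, rule allI)
  fix y
  have le: "ennreal \<bar>f x - f y\<bar> \<le> ennreal L * d x y"
    using assms unfolding lipschitz_wrt_def by auto
  \<comment> \<open>At distance 0 the Lipschitz bound makes the numerator vanish, and 0 / 0 = 0 in
    \<open>ennreal\<close>; at infinite distance the quotient is 0.\<close>
  show "ennreal \<bar>f x - f y\<bar> / d x y \<le> ennreal L"
  proof (cases "d x y = 0 \<or> d x y = \<top>")
    case True
    then show ?thesis using le by auto
  next
    case False
    have "ennreal \<bar>f x - f y\<bar> / d x y \<le> ennreal L * d x y / d x y"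
      by (rule divide_right_mono_ennreal[OF le])
    also have "\<dots> = ennreal L"
      using False by (simp add: ennreal_mult_divide_eq top.not_eq_extremum)
    finally show ?thesis .
  qed
qed

lemma slope_locally_constant:
  assumes "open U" "x \<in> U" "\<And>y. y \<in> U \<Longrightarrow> f y = f x"
  shows "slope d f x = 0"
proof -
  have "slope d f x \<le> 0"
    unfolding slope_def
  proof (rule Limsup_bounded)
    have "eventually (\<lambda>y. y \<in> U) (at x)"
      using assms(1,2) by (rule eventually_at_in_open')
    then show "eventually (\<lambda>y. ennreal \<bar>f x - f y\<bar> / d x y \<le> 0) (at x)"
      by eventually_elim (simp add: assms(3))
  qed
  then show ?thesis by simp
qed

text \<open>By Cauchy-Schwarz, (E X)^2 is at most E X^2 times the probability that \<open>X\<close>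
  is nonzero, hence at most half of E X^2. The proof expands the square of
  \<open>X - t * indicator ?A\<close> instead of quoting that inequality.\<close>

lemma (in prob_space) variance_ge_half_second_moment:
  fixes X :: "'a \<Rightarrow> real"
  assumes X[measurable]: "X \<in> borel_measurable M"
    and bound: "\<And>x. x \<in> space M \<Longrightarrow> \<bar>X x\<bar> \<le> b"
    and null: "prob {x \<in> space M. X x = 0} \<ge> 1/2"
  shows "variance X \<ge> expectation (\<lambda>x. (X x)\<^sup>2) / 2"
proof -
  \<comment> \<open>This value minimises E X^2 - 2 t E X + t^2 / 2.\<close>
  define t where "t = 2 * expectation X"
  let ?A = "{x \<in> space M. X x \<noteq> 0}"
  have iX: "integrable M X"
    by (rule integrable_const_bound[where B=b]) (use bound in auto)
  have iX2: "integrable M (\<lambda>x. (X x)\<^sup>2)"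
    by (rule integrable_const_bound[where B="b\<^sup>2"]) (use bound in \<open>auto simp flip: abs_le_square_iff intro!: order_trans[OF bound]\<close>)
  have iA: "integrable M (indicator ?A :: 'a \<Rightarrow> real)"
    by (rule integrable_real_indicator) (auto simp: emeasure_eq_measure)
  have A: "prob ?A \<le> 1/2"
  proof -
    have "prob ?A = 1 - prob {x \<in> space M. X x = 0}"
      by (subst prob_compl[symmetric]) (auto intro!: arg_cong[where f=prob])
    then show ?thesis using null by simp
  qed
  have "0 \<le> expectation (\<lambda>x. (X x - t * indicator ?A x)\<^sup>2)"
    by simp
  also have "\<dots> = expectation (\<lambda>x. (X x)\<^sup>2 - 2 * t * X x + t\<^sup>2 * indicator ?A x)"
    by (rule Bochner_Integration.integral_cong)
      (auto simp: indicator_def power2_eq_square algebra_simps)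
  also have "\<dots> = expectation (\<lambda>x. (X x)\<^sup>2) - 2 * t * expectation X + t\<^sup>2 * prob ?A"
    using iX iX2 iA by simp
  also have "\<dots> \<le> expectation (\<lambda>x. (X x)\<^sup>2) - 2 * t * expectation X + t\<^sup>2 * (1/2)"
    using A by (intro add_left_mono mult_left_mono) auto
  also have "\<dots> = expectation (\<lambda>x. (X x)\<^sup>2) - 2 * (expectation X)\<^sup>2"
    by (simp add: t_def power2_eq_square)
  finally show ?thesis
    using variance_eq[OF iX iX2] by simp
qed

lemma Osc_le:
  assumes "\<And>x. a \<le> f x" "\<And>x. f x \<le> b"
  shows "Osc f \<le> ennreal (b - a)"
proof -
  have "(SUP x. ereal (f x)) \<le> ereal b" "ereal a \<le> (INF x. ereal (f x))"
    using assms by (auto intro: SUP_least INF_greatest)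
  then have "(SUP x. ereal (f x)) - (INF x. ereal (f x)) \<le> ereal b - ereal a"
    by (rule ereal_minus_mono)
  then have "Osc f \<le> e2ennreal (ereal (b - a))"
    unfolding Osc_def by (intro e2ennreal_mono) simp
  then show ?thesis by simp
qed

section \<open>Tail estimates\<close>

text \<open>Isolates what the tail estimates take from the geometry: an extended distance for which
  Lipschitz functions are continuous, hence Borel measurable with open strict level sets.\<close>

locale weak_gap_space = prob_space \<mu> for \<mu> :: "'a::topological_space measure" +
  fixes d :: "'a \<Rightarrow> 'a \<Rightarrow> ennreal" and \<beta> :: "real \<Rightarrow> real"
  assumes borel_sets: "sets \<mu> = sets borel"
    and gap: "weak_spectral_gap d \<mu> \<beta>"
    and gap_nonneg: "s > 0 \<Longrightarrow> \<beta> s \<ge> 0"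
    and lipschitz_continuous: "lipschitz_wrt d C UNIV f \<Longrightarrow> continuous_on UNIV f"
begin

lemma space_UNIV [simp]: "space \<mu> = UNIV"
  using sets_eq_imp_space_eq[OF borel_sets] by simp

lemma pred_events: "Measurable.pred \<mu> P \<Longrightarrow> {x. P x} \<in> events"
  by (simp add: pred_def)

lemma lipschitz_measurable:
  assumes "lipschitz_wrt d C UNIV f"
  shows "f \<in> borel_measurable \<mu>"
  using borel_measurable_continuous_onI[OF lipschitz_continuous[OF assms]]
  by (simp add: measurable_cong_sets[OF borel_sets refl])

text \<open>
  Truncating \<open>F\<close> between \<open>a > t\<close> and \<open>b\<close> places the support of the slope inside
  \<open>{t < F \<le> b}\<close> without any information on the level sets of \<open>F\<close> (no Rademacher theorem).
\<close>

lemma truncation_bound: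
  assumes F: "lipschitz_wrt d L UNIV F" and L: "L \<ge> 0" and s: "s > 0" and ab: "t < a" "a < b"
    and half: "prob {x. F x \<le> t} \<ge> 1/2"
  shows "(b - a)\<^sup>2 * prob {x. F x > b} / 2
     \<le> L\<^sup>2 * \<beta> s * (prob {x. F x > t} - prob {x. F x > b}) + s * (b - a)\<^sup>2"
proof -
  define f where "f x = max 0 (min (b - a) (F x - a))" for x
  have lip: "lipschitz_wrt d L UNIV f"
  proof -
    have "ennreal \<bar>f x - f y\<bar> \<le> ennreal \<bar>F x - F y\<bar>" for x y
      by (rule ennreal_leI) (auto simp: f_def max_def min_def)
    then show ?thesis using F unfolding lipschitz_wrt_def by (meson order_trans)
  qed
  have F_cont: "continuous_on UNIV F" by (rule lipschitz_continuous[OF F])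
  have [measurable]: "F \<in> borel_measurable \<mu>" "f \<in> borel_measurable \<mu>"
    using lipschitz_measurable F lip by auto
  have sets[measurable]: "{x. F x > u} \<in> events" "{x. F x \<le> u} \<in> events" "{x. f x = u} \<in> events" for u
    by (intro pred_events; measurable)+
  have bnd: "0 \<le> f x" "f x \<le> b - a" for x using ab by (auto simp: f_def)
  have loclip: "locally_lipschitz_wrt d f"
    unfolding locally_lipschitz_wrt_def using lip L by blast
  let ?S = "{x. F x > t} - {x. F x > b}"
  have slope: "(slope d f x)\<^sup>2 \<le> ennreal (L\<^sup>2) * indicator ?S x" for x
  proof (cases "x \<in> ?S")
    case True
    then show ?thesis
      using power_mono[OF slope_le[OF lip], of x 2] L by (simp add: ennreal_power)
  next
    case False
    \<comment> \<open>Outside \<open>?S\<close> the truncation is constant near \<open>x\<close>: it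
      is 0 on the open set \<open>{x. F x < a}\<close>, which contains
      \<open>{x. F x \<le> t}\<close>, and \<open>b - a\<close> on the open set
      \<open>{x. F x > b}\<close>.\<close>
    have "slope d f x = 0"
    proof (cases "F x \<le> t")
      case True
      show ?thesis
        by (rule slope_locally_constant[where U="{x. F x < a}"])
          (use True ab in \<open>auto simp: f_def intro!: open_Collect_less F_cont\<close>)
    next
      case F: False
      show ?thesis
        by (rule slope_locally_constant[where U="{x. F x > b}"])
          (use False F ab in \<open>auto simp: f_def intro!: open_Collect_less F_cont\<close>)
    qed
    then show ?thesis by simp
  qed
  have "(\<integral>\<^sup>+ x. (slope d f x)\<^sup>2 \<partial>\<mu>) \<le> (\<integral>\<^sup>+ x. ennreal (L\<^sup>2) * indicator ?S x \<partial>\<mu>)"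
    by (rule nn_integral_mono) (rule slope)
  also have "\<dots> = ennreal (L\<^sup>2) * emeasure \<mu> ?S"
    by (rule nn_integral_cmult_indicator) measurable
  also have "\<dots> = ennreal (L\<^sup>2 * prob ?S)"
    by (simp add: emeasure_eq_measure ennreal_mult)
  also have "prob ?S = prob {x. F x > t} - prob {x. F x > b}"
    by (rule finite_measure_Diff) (use ab in auto)
  finally have energy: "(\<integral>\<^sup>+ x. (slope d f x)\<^sup>2 \<partial>\<mu>)
      \<le> ennreal (L\<^sup>2 * (prob {x. F x > t} - prob {x. F x > b}))" .
  \<comment> \<open>Makes the difference of the two tails nonnegative, so that the
    \<open>ennreal\<close> inequality below can be read in the reals.\<close>
  have mono: "prob {x. F x > b} \<le> prob {x. F x > t}"
    by (rule finite_measure_mono) (use ab in auto)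
  have osc: "Osc f \<le> ennreal (b - a)"
    using Osc_le[of 0 f "b - a"] bnd by simp
  have "ennreal (variance f) \<le> ennreal (\<beta> s) * (\<integral>\<^sup>+ x. (slope d f x)\<^sup>2 \<partial>\<mu>) + ennreal s * (Osc f)\<^sup>2"
    using gap loclip s unfolding weak_spectral_gap_def by blast
  also have "\<dots> \<le> ennreal (\<beta> s) * ennreal (L\<^sup>2 * (prob {x. F x > t} - prob {x. F x > b}))
      + ennreal s * (ennreal (b - a))\<^sup>2"
    by (intro add_mono mult_left_mono energy power_mono osc) auto
  also have "\<dots> = ennreal (\<beta> s * (L\<^sup>2 * (prob {x. F x > t} - prob {x. F x > b})) + s * (b - a)\<^sup>2)"
    using gap_nonneg[OF s] s mono ab
    by (subst ennreal_plus) (simp_all add: ennreal_power ennreal_mult)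
  finally have var: "variance f \<le> L\<^sup>2 * \<beta> s * (prob {x. F x > t} - prob {x. F x > b}) + s * (b - a)\<^sup>2"
    using gap_nonneg[OF s] s mono by (subst (asm) ennreal_le_iff) (auto simp: mult.assoc mult.left_commute)
  have "expectation (\<lambda>x. (f x)\<^sup>2) / 2 \<le> variance f"
  proof (rule variance_ge_half_second_moment)
    have "{x. F x \<le> t} \<subseteq> {x. f x = 0}" using ab by (auto simp: f_def)
    then show "1/2 \<le> prob {x \<in> space \<mu>. f x = 0}"
      using half finite_measure_mono[of "{x. F x \<le> t}" "{x. f x = 0}"] by auto
  qed (use bnd in auto)
  \<comment> \<open>Markov's inequality: \<open>f\<close> equals \<open>b - a\<close> wherever
    \<open>F > b\<close>.\<close>
  moreover have "(b - a)\<^sup>2 * prob {x. F x > b} \<le> expectation (\<lambda>x. (f x)\<^sup>2)"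
  proof -
    have "(b - a)\<^sup>2 * prob {x. F x > b} = expectation (\<lambda>x. (b - a)\<^sup>2 * indicator {x. F x > b} x)"
      by simp
    also have "\<dots> \<le> expectation (\<lambda>x. (f x)\<^sup>2)"
    proof (rule integral_mono)
      show "integrable \<mu> (\<lambda>x. (f x)\<^sup>2)"
        by (rule integrable_const_bound[where B="(b - a)\<^sup>2"]) (auto intro!: power_mono bnd)
      show "integrable \<mu> (\<lambda>x. (b - a)\<^sup>2 * indicator {x. F x > b} x)"
        by (intro integrable_mult_right integrable_real_indicator sets(1)) (simp add: emeasure_eq_measure)
    qed (use ab in \<open>auto simp: f_def indicator_def\<close>)
    finally show ?thesis .
  qed
  ultimately show ?thesis using var by simp
qed

text \<open>\<open>truncation_bound\<close> requires a gap between \<open>t\<close> and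
  \<open>a\<close>. Take \<open>a = t + \<epsilon>\<close> and \<open>b = t + 1\<close>, and let
  \<epsilon> tend to 0 from the right.\<close>

lemma one_step:
  assumes F: "lipschitz_wrt d L UNIV F" and L: "L \<ge> 0" and s: "s > 0"
    and half: "prob {x. F x \<le> t} \<ge> 1/2"
  shows "prob {x. F x > t + 1} \<le> s / (1 + L\<^sup>2 * \<beta> s)
     + prob {x. F x > t} * (1 - 1 / (2 * (1 + L\<^sup>2 * \<beta> s)))"
proof -
  define B where "B = L\<^sup>2 * \<beta> s"
  define p q where "p = prob {x. F x > t}" and "q = prob {x. F x > t + 1}"
  have B: "B \<ge> 0" using gap_nonneg[OF s] by (simp add: B_def)
  have [measurable]: "F \<in> borel_measurable \<mu>" by (rule lipschitz_measurable[OF F])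
  have "{x. F x > t} \<in> events" by (intro pred_events; measurable)
  then have qp: "q \<le> p" unfolding p_def q_def by (intro finite_measure_mono) auto
  have "1\<^sup>2 * q / 2 \<le> B * (p - q) + s * 1\<^sup>2"
  proof (rule tendsto_le[where F="at_right 0"])
    show "((\<lambda>\<epsilon>. (1 - \<epsilon>)\<^sup>2 * q / 2) \<longlongrightarrow> 1\<^sup>2 * q / 2) (at_right 0)"
      by (auto intro!: tendsto_eq_intros)
    show "((\<lambda>\<epsilon>. B * (p - q) + s * (1 - \<epsilon>)\<^sup>2) \<longlongrightarrow> B * (p - q) + s * 1\<^sup>2) (at_right 0)"
      by (auto intro!: tendsto_eq_intros)
    have "eventually (\<lambda>\<epsilon>::real. \<epsilon> \<in> {0<..<1}) (at_right 0)"
      by (rule eventually_at_right_real) simp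
    then show "eventually (\<lambda>\<epsilon>. (1 - \<epsilon>)\<^sup>2 * q / 2 \<le> B * (p - q) + s * (1 - \<epsilon>)\<^sup>2) (at_right 0)"
    proof eventually_elim
      case (elim \<epsilon>)
      then show ?case
        using truncation_bound[OF F L s _ _ half, of "t + \<epsilon>" "t + 1"]
        by (simp add: B_def p_def q_def)
    qed
  qed simp
  \<comment> \<open>Adding q/2 \<le> p/2 produces the factor 1 + B on the left.\<close>
  then have "(1 + B) * q \<le> s + p * (1/2 + B)"
    using qp by (simp add: algebra_simps)
  then have "q \<le> (s + p * (1/2 + B)) / (1 + B)"
    using B by (simp add: field_simps)
  also have "(s + p * (1/2 + B)) / (1 + B) = s / (1 + B) + p * ((1/2 + B) / (1 + B))"
    by (subst add_divide_distrib) simp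
  also have "(1/2 + B) / (1 + B) = 1 - 1 / (2 * (1 + B))"
    using B by (simp add: divide_simps)
  finally show ?thesis by (simp add: p_def q_def B_def)
qed

text \<open>The recursion of \<open>one_step\<close> is affine with ratio \<theta> and fixed point
  2s. The excess over 2s therefore shrinks by \<theta> at each level, starting from at most 1/2 at
  level 0.\<close>

lemma geometric_tail:
  assumes F: "lipschitz_wrt d L UNIV F" and L: "L \<ge> 0" and s: "s > 0"
    and half: "prob {x. F x \<le> 0} \<ge> 1/2"
  shows "prob {x. F x > real j} \<le> 2 * s + (1 - 1 / (2 * (1 + L\<^sup>2 * \<beta> s))) ^ j / 2"
proof (induction j)
  case 0
  have [measurable]: "F \<in> borel_measurable \<mu>" by (rule lipschitz_measurable[OF F])
  have ev: "{x. F x \<le> 0} \<in> events" by (intro pred_events; measurable)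
  have "prob {x. F x > 0} = 1 - prob {x. F x \<le> 0}"
    using prob_compl[OF ev] by (simp add: Compl_eq_Diff_UNIV[symmetric] Collect_neg_eq[symmetric] not_le)
  then show ?case using half s by simp
next
  case (Suc j)
  define B where "B = L\<^sup>2 * \<beta> s"
  define \<theta> where "\<theta> = 1 - 1 / (2 * (1 + B))"
  have B: "B \<ge> 0" using gap_nonneg[OF s] by (simp add: B_def)
  have \<theta>: "0 \<le> \<theta>" using B by (simp add: \<theta>_def field_simps)
  have [measurable]: "F \<in> borel_measurable \<mu>" by (rule lipschitz_measurable[OF F])
  have "{x. F x \<le> real j} \<in> events" by (intro pred_events; measurable)
  then have "prob {x. F x \<le> 0} \<le> prob {x. F x \<le> real j}"
    by (intro finite_measure_mono) auto
  then have "prob {x. F x > real j + 1} \<le> s / (1 + B) + prob {x. F x > real j} * \<theta>"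
    unfolding B_def \<theta>_def by (intro one_step[OF F L s]) (use half in auto)
  also have "\<dots> \<le> s / (1 + B) + (2 * s + \<theta> ^ j / 2) * \<theta>"
    using Suc \<theta> unfolding \<theta>_def B_def by (intro add_left_mono mult_right_mono) auto
  also have "\<dots> = s / (1 + B) + 2 * s * \<theta> + \<theta> ^ Suc j / 2"
    by (simp add: algebra_simps)
  \<comment> \<open>The fixed point equation, since 1 - \<theta> = 1 / (2 (1 + B)).\<close>
  also have "s / (1 + B) + 2 * s * \<theta> = 2 * s"
    using B by (simp add: \<theta>_def divide_simps) (simp add: algebra_simps)
  finally show ?case by (simp add: \<theta>_def B_def add.commute)
qed

lemma lipschitz_scale:
  assumes "lipschitz_wrt d L UNIV F" "L \<ge> 0"
  shows "lipschitz_wrt d (\<bar>\<kappa>\<bar> * L) UNIV (\<lambda>x. \<kappa> * (F x - m))"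
  unfolding lipschitz_wrt_def
proof (intro ballI)
  fix x y
  have "ennreal \<bar>\<kappa> * (F x - m) - \<kappa> * (F y - m)\<bar> = ennreal \<bar>\<kappa>\<bar> * ennreal \<bar>F x - F y\<bar>"
    by (simp add: abs_mult flip: ennreal_mult right_diff_distrib)
  also have "\<dots> \<le> ennreal \<bar>\<kappa>\<bar> * (ennreal L * d x y)"
    using assms unfolding lipschitz_wrt_def by (intro mult_left_mono) auto
  finally show "ennreal \<bar>\<kappa> * (F x - m) - \<kappa> * (F y - m)\<bar> \<le> ennreal (\<bar>\<kappa>\<bar> * L) * d x y"
    using assms(2) by (simp add: ennreal_mult mult.assoc)
qed

text \<open>
  Applying the geometric decay to \<open>\<kappa> (F - m)\<close> with \<open>\<kappa> = 1 / (L * sqrt (\<beta> s))\<close> makes the ratio \<open>3/4\<close>.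
  If \<open>\<beta> s = 0\<close>, the ratio is \<open>1/2\<close> for every \<open>\<kappa>\<close>.
\<close>

lemma exponential_tail:
  assumes F: "lipschitz_wrt d L UNIV F" and L: "L > 0" and s: "s > 0"
    and half: "prob {x. F x \<le> m} \<ge> 1/2" and k: "k \<ge> 1"
  shows "prob {x. F x - m > real k}
    \<le> 2 * s + sqrt (exp 1) / 2 * exp_quot (real k) (4 * L * sqrt (\<beta> s))"
proof -
  \<comment> \<open>The event \<open>F - m > k\<close> implies
    \<open>\<kappa> * (F - m) > j\<close>, and the rescaled function is Lipschitz with constant
    \<open>\<kappa> * L\<close>.\<close>
  have tail: "prob {x. F x - m > real k}
      \<le> 2 * s + (1 - 1 / (2 * (1 + (\<kappa> * L)\<^sup>2 * \<beta> s))) ^ j / 2"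
    if \<kappa>: "\<kappa> > 0" and j: "real j \<le> \<kappa> * real k" for \<kappa> j
  proof -
    have lip: "lipschitz_wrt d (\<kappa> * L) UNIV (\<lambda>x. \<kappa> * (F x - m))"
      using lipschitz_scale[OF F, of \<kappa> m] L \<kappa> by simp
    have [measurable]: "F \<in> borel_measurable \<mu>" by (rule lipschitz_measurable[OF F])
    have ev: "{x. \<kappa> * (F x - m) > real j} \<in> events" by (intro pred_events; measurable)
    have "prob {x. F x - m > real k} \<le> prob {x. \<kappa> * (F x - m) > real j}"
    proof (rule finite_measure_mono[OF _ ev], safe)
      fix x assume "real k < F x - m"
      then have "\<kappa> * real k < \<kappa> * (F x - m)" using \<kappa> by simp
      then show "real j < \<kappa> * (F x - m)" using j by simp
    qed
    also have "\<dots> \<le> 2 * s + (1 - 1 / (2 * (1 + (\<kappa> * L)\<^sup>2 * \<beta> s))) ^ j / 2"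
      by (rule geometric_tail[OF lip]) (use L \<kappa> s half in \<open>auto simp: mult_le_0_iff\<close>)
    finally show ?thesis .
  qed
  show ?thesis
  proof (cases "\<beta> s = 0")
    case True
    \<comment> \<open>The scale \<open>\<kappa> = n + 1\<close> permits \<open>n\<close> steps; as
      \<open>n\<close> grows the geometric term disappears, in agreement with
      \<open>exp_quot\<close> being 0.\<close>
    have "prob {x. F x - m > real k} \<le> 2 * s + (1/2) ^ n / 2" for n
    proof -
      have "real n \<le> (real n + 1) * real k"
        using mult_mono[of "real n" "real n + 1" 1 "real k"] k by simp
      then show ?thesis
        using tail[of "real n + 1" n] True by simp
    qed
    moreover have "(\<lambda>n. 2 * s + (1/2) ^ n / 2) \<longlonglongrightarrow> 2 * s + 0 / 2"
      by (intro tendsto_intros LIMSEQ_power_zero) auto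
    ultimately have "prob {x. F x - m > real k} \<le> 2 * s"
      by (intro LIMSEQ_le_const[where X="\<lambda>n. 2 * s + (1/2) ^ n / 2"]) auto
    then show ?thesis using True by (simp add: exp_quot_def)
  next
    case False
    then have \<beta>: "\<beta> s > 0" using gap_nonneg[OF s] by simp
    define \<kappa> where "\<kappa> = 1 / (L * sqrt (\<beta> s))"
    define j where "j = nat \<lfloor>\<kappa> * real k\<rfloor>"
    have \<kappa>: "\<kappa> > 0" using L \<beta> by (simp add: \<kappa>_def)
    have j: "real j \<le> \<kappa> * real k" "\<kappa> * real k \<le> real j + 1"
      using \<kappa> unfolding j_def by (auto simp: mult_nonneg_nonneg less_imp_le)
    have one: "(\<kappa> * L)\<^sup>2 * \<beta> s = 1"
      using L \<beta> by (simp add: \<kappa>_def power_mult_distrib power_divide)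
    \<comment> \<open>Instance of 1 + x \<le> exp x.\<close>
    have "(3/4::real) \<le> exp (- 1/4)"
      using exp_ge_add_one_self[of "- 1/4 :: real"] by simp
    then have "(3/4::real) ^ j \<le> exp (- 1/4) ^ j"
      by (intro power_mono) auto
    also have "\<dots> = exp (- real j / 4)"
      by (simp flip: exp_of_nat_mult)
    \<comment> \<open>Rounding \<open>\<kappa> * k\<close> down to \<open>j\<close> costs at most a
      factor exp (1/4), which is below sqrt e = exp (1/2).\<close>
    also have "\<dots> \<le> exp (1/2 + - (\<kappa> * real k) / 4)"
      using j by simp
    also have "\<dots> = sqrt (exp 1) * exp (- (\<kappa> * real k) / 4)"
    proof -
      have "sqrt (exp 1) = exp (1/2 :: real)"
        by (rule real_sqrt_unique) (simp_all flip: exp_double)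
      then show ?thesis by (simp only: exp_add)
    qed
    also have "exp (- (\<kappa> * real k) / 4) = exp_quot (real k) (4 * L * sqrt (\<beta> s))"
      using L \<beta> by (simp add: exp_quot_def \<kappa>_def field_simps)
    finally show ?thesis
      using tail[OF \<kappa> j(1)] unfolding one by simp
  qed
qed

end

section \<open>The function \<open>Theta\<close> and its limit at infinity\<close>

lemma Theta_bounds:
  assumes "s \<in> {0<..1/4}" "exp_quot u (4 * sqrt (if s < 1/4 then \<beta> s else 0)) \<le> s"
  shows "0 \<le> Theta \<beta> u" "Theta \<beta> u \<le> s"
proof -
  show "0 \<le> Theta \<beta> u"
    unfolding Theta_def by (rule cInf_greatest) (use assms in auto)
  show "Theta \<beta> u \<le> s"
    unfolding Theta_def by (rule cInf_lower) (use assms in \<open>auto intro: bdd_belowI[of _ 0]\<close>)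
qed

text \<open>The point 1/4 is always admissible, so the set is nonempty and the first assumption
  handles this point; at every other candidate \<open>\<beta> s\<close> keeps its own value.\<close>

lemma le_Theta:
  assumes "c \<le> 1/4"
    and "\<And>s. 0 < s \<Longrightarrow> s < 1/4 \<Longrightarrow> exp_quot u (4 * sqrt (\<beta> s)) \<le> s \<Longrightarrow> c \<le> s"
  shows "c \<le> Theta \<beta> u"
  unfolding Theta_def
proof (rule cInf_greatest)
  have "1/4 \<in> {s \<in> {0<..1/4}. exp_quot u (4 * sqrt (if s < 1/4 then \<beta> s else 0)) \<le> s}"
    by (simp add: exp_quot_def)
  then show "{s \<in> {0<..1/4}. exp_quot u (4 * sqrt (if s < 1/4 then \<beta> s else 0)) \<le> s} \<noteq> {}"
    by blast
  show "c \<le> s" if "s \<in> {s \<in> {0<..1/4}. exp_quot u (4 * sqrt (if s < 1/4 then \<beta> s else 0)) \<le> s}" for s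
    using that assms by (cases "s = 1/4") auto
qed

text \<open>For a fixed \<open>s\<close> below \<open>e\<close> the exponential tends to 0 as
  \<open>u\<close> grows, so \<open>s\<close> is eventually admissible and bounds
  \<open>Theta \<beta> u\<close>.\<close>

lemma Theta_tendsto_0:
  assumes "\<And>s. s > 0 \<Longrightarrow> \<beta> s \<ge> 0"
  shows "(Theta \<beta> \<longlongrightarrow> 0) at_top"
proof (rule order_tendstoI)
  have nonneg: "0 \<le> Theta \<beta> u" for u
    by (rule Theta_bounds(1)[where s="1/4"]) (auto simp: exp_quot_def)
  show "eventually (\<lambda>u. e < Theta \<beta> u) at_top" if "e < 0" for e
    using that nonneg by (auto intro: always_eventually less_le_trans)
next
  fix e :: real assume e: "0 < e"
  \<comment> \<open>Staying strictly below 1/4 ensures that \<open>\<beta> s\<close> itself occurs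
    in the condition.\<close>
  define s where "s = min (e / 2) (1/8)"
  have s: "0 < s" "s < 1/4" "s < e" using e by (auto simp: s_def)
  have "eventually (\<lambda>u. exp_quot u (4 * sqrt (\<beta> s)) \<le> s) at_top"
  proof (cases "\<beta> s = 0")
    case True
    then show ?thesis using s by (simp add: exp_quot_def)
  next
    case False
    define b where "b = 4 * sqrt (\<beta> s)"
    have b: "b > 0" using False assms[OF s(1)] by (simp add: b_def)
    show ?thesis
      \<comment> \<open>The threshold is the solution \<open>u\<close> of exp (-u / b) = s.\<close>
      unfolding b_def[symmetric] using eventually_ge_at_top[of "- b * ln s"]
    proof eventually_elim
      case (elim u)
      then have "- u / b \<le> ln s" using b by (simp add: field_simps)
      then have "exp (- u / b) \<le> s" using s(1) by (simp add: ln_ge_iff)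
      then show ?case using b by (simp add: exp_quot_def)
    qed
  qed
  then show "eventually (\<lambda>u. Theta \<beta> u < e) at_top"
    by eventually_elim (use s Theta_bounds(2)[of s] in force)
qed

section \<open>Two-sided tail bound\<close>

context weak_gap_space
begin

text \<open>Apply \<open>exponential_tail\<close> to \<open>F\<close> and to \<open>- F\<close>,
  with medians \<open>m\<close> and \<open>- m\<close>. For admissible \<open>s\<close> below 1/4
  each tail is at most 2s + s, because sqrt e / 2 \<le> 1; together they give 6s.\<close>

lemma two_sided_tail:
  assumes F: "lipschitz_wrt d L UNIV F" and L: "L > 0" and med: "is_median \<mu> F m" and k: "k \<ge> 1"
  shows "prob {x. \<bar>F x - m\<bar> > real k} \<le> 6 * Theta \<beta> (real k / L)"
proof -
  have G: "lipschitz_wrt d L UNIV (\<lambda>x. - F x)"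
    using F unfolding lipschitz_wrt_def by (simp add: abs_minus_commute)
  have half: "prob {x. F x \<le> m} \<ge> 1/2" "prob {x. - F x \<le> - m} \<ge> 1/2"
    using med by (auto simp: is_median_def)
  have [measurable]: "F \<in> borel_measurable \<mu>" by (rule lipschitz_measurable[OF F])
  have ev: "{x. F x - m > real k} \<in> events" "{x. - F x - (- m) > real k} \<in> events"
    by (intro pred_events; measurable)+
  have "{x. \<bar>F x - m\<bar> > real k} = {x. F x - m > real k} \<union> {x. - F x - (- m) > real k}"
    by auto
  then have union: "prob {x. \<bar>F x - m\<bar> > real k}
      \<le> prob {x. F x - m > real k} + prob {x. - F x - (- m) > real k}"
    using measure_Un_le[OF ev(1,2)] by simp
  have "prob {x. \<bar>F x - m\<bar> > real k} / 6 \<le> Theta \<beta> (real k / L)"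
  proof (rule le_Theta)
    \<comment> \<open>At s = 1/4 the claim is trivial, since 6/4 exceeds 1.\<close>
    show "prob {x. \<bar>F x - m\<bar> > real k} / 6 \<le> 1/4"
      using prob_le_1[of "{x. \<bar>F x - m\<bar> > real k}"] by linarith
  next
    fix s :: real
    assume s: "0 < s" "s < 1/4" and e: "exp_quot (real k / L) (4 * sqrt (\<beta> s)) \<le> s"
    have "exp_quot (real k) (4 * L * sqrt (\<beta> s)) \<le> s"
      using e L by (simp add: exp_quot_def ac_simps split: if_splits)
    moreover have "sqrt (exp 1) / 2 \<le> 1"
      using real_sqrt_le_mono[of "exp 1" 4] exp_le by simp
    ultimately have "sqrt (exp 1) / 2 * exp_quot (real k) (4 * L * sqrt (\<beta> s)) \<le> 1 * s"
      by (intro mult_mono) (auto simp: exp_quot_def)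
    then show "prob {x. \<bar>F x - m\<bar> > real k} / 6 \<le> s"
      using exponential_tail[OF F L s(1) half(1) k] exponential_tail[OF G L s(1) half(2) k] union
      by simp
  qed
  then show ?thesis by simp
qed

end

theorem theorem8:
  fixes A :: "('a::{second_countable_topology, t2_space}, 'n::finite) chart set"
    and g :: "('a, 'n) metric_tensor"
    and \<mu> :: "'a measure"
    and \<beta> :: "real \<Rightarrow> real"
    and F :: "'a \<Rightarrow> real"
    and L m :: real
  assumes "riemannian_manifold A g"
    and "prob_space \<mu>"
    and "sets \<mu> = sets borel"
    and "absolutely_continuous (riemannian_volume A g) \<mu>"
    and "\<And>s. s > 0 \<Longrightarrow> \<beta> s \<ge> 0"
    and "antimono_on {0<..} \<beta>"
    and "weak_spectral_gap (geodesic_dist A g) \<mu> \<beta>"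
    and "L > 0"
    and "lipschitz_wrt (geodesic_dist A g) L UNIV F"
    and "is_median \<mu> F m"
  shows "(\<forall>k::nat. \<forall>s::real. k \<ge> 1 \<longrightarrow> 0 < s \<longrightarrow> s < 1/4 \<longrightarrow>
            measure \<mu> {x \<in> space \<mu>. F x - m > real k}
              \<le> s / (1 + L\<^sup>2 * \<beta> s)
                + measure \<mu> {x \<in> space \<mu>. F x - m > real k - 1}
                  * (1 - 1 / (2 * (1 + L\<^sup>2 * \<beta> s))))
       \<and> (\<forall>k::nat. \<forall>s::real. k \<ge> 1 \<longrightarrow> 0 < s \<longrightarrow> s < 1/4 \<longrightarrow>
            measure \<mu> {x \<in> space \<mu>. F x - m > real k}
              \<le> 2 * s + sqrt (exp 1) / 2 * exp_quot (real k) (4 * L * sqrt (\<beta> s)))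
       \<and> (\<forall>k::nat. k \<ge> 1 \<longrightarrow>
            measure \<mu> {x \<in> space \<mu>. \<bar>F x - m\<bar> > real k} \<le> 6 * Theta \<beta> (real k / L))
       \<and> (Theta \<beta> \<longlongrightarrow> 0) at_top"
proof -
  interpret riemannian_manifold A g by fact
  interpret prob_space \<mu> by fact
  \<comment> \<open>The geometry enters here, through
    \<open>lipschitz_imp_continuous\<close>.\<close>
  interpret weak_gap_space \<mu> "geodesic_dist A g" \<beta>
    by unfold_locales (fact assms lipschitz_imp_continuous)+
  have half: "prob {x. F x \<le> m} \<ge> 1/2"
    using assms(10) by (simp add: is_median_def)
  have [measurable]: "F \<in> borel_measurable \<mu>" by (rule lipschitz_measurable[OF assms(9)])
  have step: "prob {x. F x - m > real k} \<le> s / (1 + L\<^sup>2 * \<beta> s)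
      + prob {x. F x - m > real k - 1} * (1 - 1 / (2 * (1 + L\<^sup>2 * \<beta> s)))"
    if k: "k \<ge> 1" and s: "0 < s" for k :: nat and s
  proof -
    \<comment> \<open>Since \<open>k \<ge> 1\<close>, this level is at least the median, so
      \<open>{x. F x \<le> ?t}\<close> still has probability at least 1/2.\<close>
    let ?t = "m + (real k - 1)"
    have ev: "{x. F x \<le> ?t} \<in> events" by (intro pred_events; measurable)
    have "prob {x. F x \<le> m} \<le> prob {x. F x \<le> ?t}"
      by (rule finite_measure_mono[OF _ ev]) (use k in auto)
    then have "prob {x. F x > ?t + 1} \<le> s / (1 + L\<^sup>2 * \<beta> s)
        + prob {x. F x > ?t} * (1 - 1 / (2 * (1 + L\<^sup>2 * \<beta> s)))"
      using half assms(8) by (intro one_step[OF assms(9) _ s]) auto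
    moreover have "{x. F x > ?t + 1} = {x. F x - m > real k}" "{x. F x > ?t} = {x. F x - m > real k - 1}"
      by auto
    ultimately show ?thesis by simp
  qed
  show ?thesis
    using step exponential_tail[OF assms(9,8) _ half] two_sided_tail[OF assms(9,8,10)]
      Theta_tendsto_0[OF assms(5)]
    by simp
qed

end
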